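(* Let $\mathbb{F}_q$ be a finite field with $q$ elements, let $A\subset\mathbb{F}_q$ with $|A|>\sqrt q$, and let $E=A\times A\times A\subset\mathbb{F}_q^3$. Then $$|vol(E)|>\frac q2.$$
   Context: For $x^1,x^2,x^3\in\mathbb{F}_q^3$, $vol(x^1,x^2,x^3)$ is the determinant of the $3\times3$ matrix with rows $x^1,x^2,x^3$, and $vol(E)=\{vol(x^1,x^2,x^3): x^1,x^2,x^3\in E\}\subset\mathbb{F}_q$. *)

theory Defs
  imports "HOL-Analysis.Analysis"
begin

definition vol :: "'a::field ^ 3 \<Rightarrow> 'a ^ 3 \<Rightarrow> 'a ^ 3 \<Rightarrow> 'a" where
  \<comment> \<open>in \<open>'a ^ 3 ^ 3\<close> the outer index is the row index, so the arguments are the rows\<close>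
  "vol x1 x2 x3 = det (vector [x1, x2, x3] :: 'a ^ 3 ^ 3)"

definition vol_set :: "('a::field ^ 3) set \<Rightarrow> 'a set" where
  "vol_set E = {vol x1 x2 x3 | x1 x2 x3. x1 \<in> E \<and> x2 \<in> E \<and> x3 \<in> E}"

definition cube :: "'a set \<Rightarrow> ('a ^ 3) set" where
  "cube A = {x. x $ 1 \<in> A \<and> x $ 2 \<in> A \<and> x $ 3 \<in> A}"

end

(* If |A|^2 > q, then for every r the map (u, v) |-> u + r v on A x A has a collision, so every r is a
   quotient c / b of differences of A.  Averaging the number of collisions over r \<noteq> 0 and applying
   Cauchy-Schwarz gives an r with |A + r A| > q/2, hence |b A + c A| > q/2.  Finally, if the last
   two rows of the matrix share a nonzero third entry t, the first two cofactors of the first row are t times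
   arbitrary elements of A - A, so vol(E) contains a translate of a dilate of b A + c A. *)
theory Submission
  imports Defs
begin

text \<open>Cauchy-Schwarz for the fibre sizes of \<open>f\<close>: they sum to
  \<open>card X\<close>, and their squares sum to the number of ordered pairs in \<open>X\<close> on
  which \<open>f\<close> agrees.\<close>

lemma card_squared_le_card_image_mult_collisions:
  assumes "finite X"
  shows "(real (card X))\<^sup>2 \<le> real (card (f ` X)) * (\<Sum>x\<in>X. real (card {y \<in> X. f x = f y}))"
proof -
  let ?fib = "\<lambda>s. {y \<in> X. s = f y}"
  have fib: "(\<Sum>s\<in>f ` X. (\<Sum>x\<in>?fib s. h x)) = sum h X" for h :: "'a \<Rightarrow> real"
    using sum.image_gen[OF assms, of h f] by (simp add: eq_commute)
  have "(\<Sum>s\<in>f ` X. real (card (?fib s))) = real (card X)"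
    using fib[of "\<lambda>_. 1"] by simp
  \<comment> \<open>A fibre of size k contributes k points, each colliding with k points, hence k
    squared in total.\<close>
  moreover have "(\<Sum>s\<in>f ` X. (real (card (?fib s)))\<^sup>2) = (\<Sum>x\<in>X. real (card (?fib (f x))))"
    unfolding fib[of "\<lambda>x. real (card (?fib (f x)))", symmetric]
  proof (rule sum.cong)
    fix s
    have "(real (card (?fib s)))\<^sup>2 = (\<Sum>x\<in>?fib s. real (card (?fib s)))"
      by (simp only: sum_constant power2_eq_square)
    also have "\<dots> = (\<Sum>x\<in>?fib s. real (card (?fib (f x))))"
      by (rule sum.cong) auto
    finally show "(real (card (?fib s)))\<^sup>2 = (\<Sum>x\<in>?fib s. real (card (?fib (f x))))" .
  qed simp
  ultimately show ?thesis
    using sum_squared_le_sum_of_squares[of "\<lambda>s. real (card (?fib s))" "f ` X"]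
    by (simp add: mult.commute)
qed

text \<open>Double counting. The point \<open>(a, b)\<close> collides with itself for every nonzero
  \<open>r\<close>. A point agreeing with it in exactly one coordinate never collides, because
  \<open>r\<close> is nonzero. Any other point collides for at most one \<open>r\<close>, the
  quotient of the coordinate differences.\<close>

lemma sum_collisions_le:
  fixes A :: "'a::{field, finite} set"
  assumes "a \<in> A" "b \<in> A"
  shows "(\<Sum>r\<in>UNIV - {0}. card {y \<in> A \<times> A. a + r * b = fst y + r * snd y})
    \<le> (CARD('a) - 1) + (card A - 1)\<^sup>2"
proof -
  let ?X = "A \<times> A" and ?R = "\<lambda>y. {r \<in> UNIV - {0}. a + r * b = fst y + r * snd y}"
  let ?B = "(A - {a}) \<times> (A - {b})"
  have le: "card (?R y) \<le> of_bool (y \<in> ?B)" if y: "y \<in> ?X - {(a, b)}" for y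
  proof -
    have key: "(a - fst y) = r * (snd y - b)" if "r \<in> ?R y" for r
      using that by (simp add: algebra_simps)
    have sub: "r = (a - fst y) / (snd y - b) \<and> fst y \<noteq> a \<and> snd y \<noteq> b" if "r \<in> ?R y" for r
      using key[OF that] that y by (cases y) auto
    show ?thesis
    proof (cases "?R y = {}")
      case False
      then have "y \<in> ?B" using sub y by (cases y) fastforce
      moreover have "card (?R y) \<le> card {(a - fst y) / (snd y - b)}"
        using sub by (intro card_mono) blast+
      ultimately show ?thesis by simp
    qed (simp only: card.empty)
  qed
  \<comment> \<open>Exchange the two sums: for each \<open>y\<close>, count the values
    \<open>r\<close> at which it collides with \<open>(a, b)\<close>.\<close>
  have "(\<Sum>r\<in>UNIV - {0}. card {y \<in> ?X. a + r * b = fst y + r * snd y}) = (\<Sum>y\<in>?X. card (?R y))"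
    using sum.swap_restrict[of "UNIV - {0}" ?X "\<lambda>_ _. 1::nat" "\<lambda>r y. a + r * b = fst y + r * snd y"]
    by simp
  also have "\<dots> = card (?R (a, b)) + (\<Sum>y\<in>?X - {(a, b)}. card (?R y))"
    using assms by (intro sum.remove) auto
  also have "card (?R (a, b)) \<le> CARD('a) - 1"
    by (rule order_trans[OF card_mono[of "UNIV - {0 :: 'a}"]]) (auto simp: card_Diff_singleton)
  also have "(\<Sum>y\<in>?X - {(a, b)}. card (?R y)) \<le> (\<Sum>y\<in>?X - {(a, b)}. of_bool (y \<in> ?B))"
    by (rule sum_mono) (rule le)
  also have "\<dots> = card ((?X - {(a, b)}) \<inter> ?B)"
    by (simp add: sum.If_cases of_bool_def Int_def)
  also have "\<dots> \<le> card ?B"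
    by (rule card_mono) auto
  also have "card ?B = (card A - 1)\<^sup>2"
    using assms by (simp add: card_cartesian_product power2_eq_square)
  finally show ?thesis by simp
qed

text \<open>If every image had at most q/2 elements, Cauchy-Schwarz would force many collisions for
  each \<open>r\<close>; summed over the nonzero \<open>r\<close>, this exceeds the bound from
  \<open>sum_collisions_le\<close>.\<close>

lemma ex_large_dilate_sumset:
  fixes A :: "'a::{field, finite} set"
  assumes big: "CARD('a) < (card A)\<^sup>2"
  shows "\<exists>r. real (card ((\<lambda>x. fst x + r * snd x) ` (A \<times> A))) > real CARD('a) / 2"
proof (rule ccontr)
  define q where "q = real CARD('a)"
  define N where "N = real (card A)"
  define C where "C r x = card {y \<in> A \<times> A. fst x + r * snd x = fst y + r * snd y}" for r x
  assume "\<not> ?thesis"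
  then have small: "real (card ((\<lambda>x. fst x + r * snd x) ` (A \<times> A))) \<le> q / 2" for r
    by (auto simp: q_def not_less)
  \<comment> \<open>A field has at least two elements; this makes the factor \<open>q - 2\<close>
    below nonnegative.\<close>
  have "card {0, 1 :: 'a} \<le> CARD('a)" by (rule card_mono) auto
  then have q: "q \<ge> 2" by (simp add: q_def)
  from big have N: "q < N\<^sup>2" by (simp add: q_def N_def flip: of_nat_power)
  have cA: "card A \<ge> 1" using big by (cases "card A") auto
  then have N1: "N \<ge> 1" by (simp add: N_def)
  have cs: "N ^ 4 \<le> q / 2 * (\<Sum>x\<in>A \<times> A. real (C r x))" for r
  proof -
    have "N ^ 4 = (real (card (A \<times> A)))\<^sup>2"
      by (simp add: N_def card_cartesian_product power2_eq_square eval_nat_numeral)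
    also have "\<dots> \<le> real (card ((\<lambda>x. fst x + r * snd x) ` (A \<times> A))) * (\<Sum>x\<in>A \<times> A. real (C r x))"
      unfolding C_def by (rule card_squared_le_card_image_mult_collisions) simp
    also have "\<dots> \<le> q / 2 * (\<Sum>x\<in>A \<times> A. real (C r x))"
      by (intro mult_right_mono small sum_nonneg) simp
    finally show ?thesis .
  qed
  have per_pair: "(\<Sum>r\<in>UNIV - {0}. real (C r x)) \<le> (q - 1) + (N - 1)\<^sup>2" if "x \<in> A \<times> A" for x
  proof -
    have "(\<Sum>r\<in>UNIV - {0}. C r x) \<le> (CARD('a) - 1) + (card A - 1)\<^sup>2"
      unfolding C_def using that by (intro sum_collisions_le) auto
    then have "real (\<Sum>r\<in>UNIV - {0}. C r x) \<le> real ((CARD('a) - 1) + (card A - 1)\<^sup>2)"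
      by (rule of_nat_mono)
    then show ?thesis
      using cA by (simp add: q_def N_def of_nat_diff Suc_leI)
  qed
  have "(q - 1) * N ^ 4 = (\<Sum>r\<in>UNIV - {0 :: 'a}. N ^ 4)"
    by (simp add: q_def card_Diff_singleton of_nat_diff Suc_leI)
  also have "\<dots> \<le> (\<Sum>r\<in>UNIV - {0 :: 'a}. q / 2 * (\<Sum>x\<in>A \<times> A. real (C r x)))"
    by (rule sum_mono) (rule cs)
  also have "\<dots> = q / 2 * (\<Sum>x\<in>A \<times> A. \<Sum>r\<in>UNIV - {0}. real (C r x))"
    by (subst sum.swap) (simp add: sum_distrib_left)
  also have "\<dots> \<le> q / 2 * (\<Sum>x\<in>A \<times> A. (q - 1) + (N - 1)\<^sup>2)"
    using q by (intro mult_left_mono sum_mono per_pair) auto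
  also have "\<dots> = N\<^sup>2 * (q / 2 * ((q - 1) + (N - 1)\<^sup>2))"
    by (simp add: N_def card_cartesian_product power2_eq_square)
  finally have "N\<^sup>2 * ((q - 1) * N\<^sup>2) \<le> N\<^sup>2 * (q / 2 * ((q - 1) + (N - 1)\<^sup>2))"
    by (simp add: power2_eq_square eval_nat_numeral algebra_simps)
  then have "(q - 1) * N\<^sup>2 \<le> q / 2 * ((q - 1) + (N - 1)\<^sup>2)"
    using N1 by (subst (asm) mult_le_cancel_left_pos) auto
  \<comment> \<open>Doubling and expanding isolates \<open>q - 2\<close> as the coefficient of
    \<open>N\<^sup>2\<close>. Replacing \<open>N\<^sup>2\<close> by the smaller \<open>q\<close>
    then leaves only \<open>N \<le> 1\<close>, against \<open>N\<^sup>2 > q \<ge> 2\<close>.\<close>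
  then have "N\<^sup>2 * (q - 2) + 2 * (q * N) \<le> q * q"
    by (simp add: power2_eq_square algebra_simps)
  moreover have "q * (q - 2) \<le> N\<^sup>2 * (q - 2)"
    using N q by (intro mult_right_mono) auto
  moreover have "q * 1 \<le> q * N"
    using q N1 by (intro mult_left_mono) auto
  ultimately have "q * N \<le> q * 1"
    by (simp add: algebra_simps)
  with q N1 have "N = 1" by simp
  with N q show False by simp
qed

text \<open>Pigeonhole: \<open>A \<times> A\<close> has more than q points, so
  \<open>(u, v) \<mapsto> u + r * v\<close> is not injective on it, and a collision writes
  \<open>r\<close> as a quotient of differences.\<close>

lemma ex_difference_quotient:
  fixes A :: "'a::{field, finite} set"
  assumes "CARD('a) < (card A)\<^sup>2"
  shows "\<exists>a\<in>A. \<exists>a'\<in>A. \<exists>d\<in>A. \<exists>d'\<in>A. d \<noteq> d' \<and> a - a' = r * (d' - d)"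
proof -
  let ?f = "\<lambda>x. fst x + r * snd x"
  have "card (?f ` (A \<times> A)) \<le> CARD('a)" by (rule card_mono) auto
  with assms have "\<not> inj_on ?f (A \<times> A)"
    by (auto dest: card_image simp: card_cartesian_product power2_eq_square)
  then obtain a d a' d' where mem: "a \<in> A" "d \<in> A" "a' \<in> A" "d' \<in> A"
    and ne: "(a, d) \<noteq> (a', d')" and eq: "a + r * d = a' + r * d'"
    by (auto simp: inj_on_def)
  have "a - a' = r * (d' - d)" using eq by (simp add: algebra_simps)
  \<comment> \<open>If \<open>d = d'\<close>, the equation would give \<open>a = a'\<close>, and the
    colliding pairs would coincide.\<close>
  moreover from this ne have "d \<noteq> d'" by auto
  ultimately show ?thesis using mem by blast
qed

text \<open>This is the determinant expanded along its first row \<open>(u, v, w)\<close>, when the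
  other two rows have the same third entry \<open>t\<close>.\<close>

lemma vol_cube_mem:
  assumes "u \<in> A" "v \<in> A" "w \<in> A" "y1 \<in> A" "y2 \<in> A" "z1 \<in> A" "z2 \<in> A" "t \<in> A"
  shows "t * (u * (y2 - z2) + v * (z1 - y1)) + w * (y1 * z2 - y2 * z1) \<in> vol_set (cube A)"
proof -
  have "t * (u * (y2 - z2) + v * (z1 - y1)) + w * (y1 * z2 - y2 * z1)
      = vol (vector [u, v, w]) (vector [y1, y2, t]) (vector [z1, z2, t])"
    by (simp add: vol_def det_3 algebra_simps)
  with assms show ?thesis
    unfolding vol_set_def cube_def by force
qed

theorem theorem2p7:
  fixes A :: "'a::{field, finite} set" and E :: "('a ^ 3) set"
  assumes "real (card A) > sqrt (real CARD('a))"
    and "E = cube A"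
  shows "real (card (vol_set E)) > real CARD('a) / 2"
proof -
  have "real CARD('a) < (real (card A))\<^sup>2"
    using assms(1) by (meson not_less real_le_rsqrt)
  then have big: "CARD('a) < (card A)\<^sup>2"
    by (simp flip: of_nat_power)
  obtain r where r: "real (card ((\<lambda>x. fst x + r * snd x) ` (A \<times> A))) > real CARD('a) / 2"
    using ex_large_dilate_sumset[OF big] by blast
  obtain a a' d d' where mem: "a \<in> A" "a' \<in> A" "d \<in> A" "d' \<in> A"
    and ne: "d \<noteq> d'" and diff: "a - a' = r * (d' - d)"
    using ex_difference_quotient[OF big] by blast
  \<comment> \<open>Of the two distinct elements \<open>d\<close> and \<open>d'\<close>, at least
    one is nonzero.\<close>
  from mem ne obtain t where t: "t \<in> A" "t \<noteq> 0" by metis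
  \<comment> \<open>\<open>g\<close> sends \<open>u + r * v\<close> to the volume with rows
    \<open>(u, v, t)\<close>, \<open>(a', d', t)\<close>, \<open>(a, d, t)\<close>. Its slope is
    nonzero, so it preserves cardinalities.\<close>
  define g where "g s = t * (d' - d) * s + t * (a' * d - d' * a)" for s
  have "inj g" using t ne by (auto simp: g_def inj_def)
  have "g (u + r * v) \<in> vol_set E" if "u \<in> A" "v \<in> A" for u v
  proof -
    have "g (u + r * v) = t * (u * (d' - d) + v * (a - a')) + t * (a' * d - d' * a)"
      unfolding diff by (simp add: g_def algebra_simps)
    also have "\<dots> \<in> vol_set E"
      unfolding assms(2) using that mem t by (intro vol_cube_mem)
    finally show ?thesis .
  qed
  then have "g ` (\<lambda>x. fst x + r * snd x) ` (A \<times> A) \<subseteq> vol_set E" by auto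
  then have "card (g ` (\<lambda>x. fst x + r * snd x) ` (A \<times> A)) \<le> card (vol_set E)"
    by (intro card_mono) auto
  then have "card ((\<lambda>x. fst x + r * snd x) ` (A \<times> A)) \<le> card (vol_set E)"
    using \<open>inj g\<close> by (simp add: card_image inj_on_subset)
  with r show ?thesis by linarith
qed

end
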